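(* Let $f\in\mathcal A$ and $L'u=f^2Lu$. Let $N\in[1,\infty)$ and $N'\in(N,\infty]$. Then for all $u\in\mathcal A$, pointwise on $X$, $$R'_{N'}(u)\ge f^4R_N(u)-\frac{(N-2)(N'-2)}{N'-N}f^2\,\Gamma(f,u)^2+\frac12\big(f^2Lf^2-\Gamma(f^2)\big)\Gamma(u).$$
   Context: Let $X$ be a set, $\mathcal A$ an algebra of real-valued functions on $X$ and $L:\mathcal A\to\mathcal A$ a linear operator. Put $\Gamma(f,g)=\frac12[L(fg)-fLg-gLf]$ and $\Gamma(f)=\Gamma(f,f)$. $L$ is assumed to be a diffusion operator: $\Gamma(f)\ge0$ for all $f\in\mathcal A$, and for all $r$, all $f_1,\dots,f_r\in\mathcal A$ and every $C^\infty$ function $\psi:\mathbb R^r\to\mathbb R$ with $\psi(0)=0$ one has $\psi(f_1,\dots,f_r)\in\mathcal A$ and $L\psi(f_1,\dots,f_r)=\sum_i\psi_i(f_1,\dots,f_r)\,Lf_i+\sum_{i,j}\psi_{ij}(f_1,\dots,f_r)\,\Gamma(f_i,f_j)$, where $\psi_i,\psi_{ij}$ are partial derivatives. Define $\Gamma_2(f,g)=\frac12[L\Gamma(f,g)-\Gamma(f,Lg)-\Gamma(g,Lf)]$, $\Gamma_2(f)=\Gamma_2(f,f)$, and for $N\in[1,\infty]$ (with $1/\infty=0$) the $N$-Ricci tensor $R_N(f)(x)=\inf\{\Gamma_2(\tilde f)(x)-\frac1N(L\tilde f)^2(x):\tilde f\in\mathcal A,\ \Gamma(\tilde f-f)(x)=0\}\in[-\infty,\infty)$.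 $R'_{N'}$ is the $N'$-Ricci tensor defined by the same formulas with $L'$ (and its square field operators $\Gamma',\Gamma'_2$) in place of $L$. For $N'=\infty$ the quotient $\frac{(N-2)(N'-2)}{N'-N}$ is read as $N-2$. Convention: $0\cdot(-\infty)=0$. *)

theory Defs
  imports "HOL-Analysis.Analysis"
begin

text \<open>
  The diffusion property quantifies over all dimensions \<open>r\<close>, so \<open>\<real>\<^sup>r\<close> cannot be a type
  \<open>real ^ 'n\<close> here. A function on \<open>\<real>\<^sup>r\<close> is encoded as a function of type
  \<open>(nat \<Rightarrow> real) \<Rightarrow> real\<close> that depends on the coordinates with index \<open>< r\<close> only. For such
  functions, continuity for the product topology on \<open>nat \<Rightarrow> real\<close> is continuity on \<open>\<real>\<^sup>r\<close>.
\<close>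

definition partial_deriv :: "nat \<Rightarrow> ((nat \<Rightarrow> real) \<Rightarrow> real) \<Rightarrow> (nat \<Rightarrow> real) \<Rightarrow> real" where
  "partial_deriv i \<psi> = (\<lambda>y. deriv (\<lambda>t. \<psi> (y(i := t))) (y i))"

definition smooth_function :: "nat \<Rightarrow> ((nat \<Rightarrow> real) \<Rightarrow> real) \<Rightarrow> bool" where
  "smooth_function r \<psi> \<longleftrightarrow>
     (\<forall>y z. (\<forall>i<r. y i = z i) \<longrightarrow> \<psi> y = \<psi> z) \<and>
     (\<forall>is. set is \<subseteq> {..<r} \<longrightarrow>
        continuous_on UNIV (foldr partial_deriv is \<psi>) \<and>
        (\<forall>i<r. \<forall>y. (\<lambda>t. foldr partial_deriv is \<psi> (y(i := t))) differentiable (at (y i))))"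

definition carre_du_champ :: "(('x \<Rightarrow> real) \<Rightarrow> 'x \<Rightarrow> real) \<Rightarrow> ('x \<Rightarrow> real) \<Rightarrow> ('x \<Rightarrow> real) \<Rightarrow> 'x \<Rightarrow> real" where
  "carre_du_champ L f g = (\<lambda>x. (1/2) * (L (\<lambda>y. f y * g y) x - f x * L g x - g x * L f x))"

definition carre_du_champ2 :: "(('x \<Rightarrow> real) \<Rightarrow> 'x \<Rightarrow> real) \<Rightarrow> ('x \<Rightarrow> real) \<Rightarrow> ('x \<Rightarrow> real) \<Rightarrow> 'x \<Rightarrow> real" where
  "carre_du_champ2 L f g = (\<lambda>x. (1/2) * (L (carre_du_champ L f g) x - carre_du_champ L f (L g) x - carre_du_champ L g (L f) x))"

definition function_algebra :: "('x \<Rightarrow> real) set \<Rightarrow> bool" where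
  "function_algebra A \<longleftrightarrow>
     (\<lambda>x. 0) \<in> A \<and>
     (\<forall>f\<in>A. \<forall>c. (\<lambda>x. c * f x) \<in> A) \<and>
     (\<forall>f\<in>A. \<forall>g\<in>A. (\<lambda>x. f x + g x) \<in> A) \<and>
     (\<forall>f\<in>A. \<forall>g\<in>A. (\<lambda>x. f x * g x) \<in> A)"

text \<open>
  \<open>L\<close> is an operator on \<open>A\<close>; its values outside \<open>A\<close> are irrelevant. The tuple
  \<open>(f\<^sub>1, \<dots>, f\<^sub>r)\<close> is \<open>f 0, \<dots>, f (r - 1)\<close>.
\<close>

locale diffusion_operator =
  fixes A :: "('x \<Rightarrow> real) set" and L :: "('x \<Rightarrow> real) \<Rightarrow> 'x \<Rightarrow> real"
  assumes algebra: "function_algebra A"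
    and maps_to: "f \<in> A \<Longrightarrow> L f \<in> A"
    and add: "f \<in> A \<Longrightarrow> g \<in> A \<Longrightarrow> L (\<lambda>x. f x + g x) = (\<lambda>x. L f x + L g x)"
    and scale: "f \<in> A \<Longrightarrow> L (\<lambda>x. c * f x) = (\<lambda>x. c * L f x)"
    and carre_du_champ_nonneg: "f \<in> A \<Longrightarrow> carre_du_champ L f f x \<ge> 0"
    and smooth_closed:
      "smooth_function r \<psi> \<Longrightarrow> \<psi> (\<lambda>i. 0) = 0 \<Longrightarrow> (\<And>i. i < r \<Longrightarrow> F i \<in> A) \<Longrightarrow>
         (\<lambda>x. \<psi> (\<lambda>i. F i x)) \<in> A"
    and chain_rule:
      "smooth_function r \<psi> \<Longrightarrow> \<psi> (\<lambda>i. 0) = 0 \<Longrightarrow> (\<And>i. i < r \<Longrightarrow> F i \<in> A) \<Longrightarrow>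
         L (\<lambda>x. \<psi> (\<lambda>i. F i x)) x =
           (\<Sum>i<r. partial_deriv i \<psi> (\<lambda>k. F k x) * L (F i) x) +
           (\<Sum>i<r. \<Sum>j<r. partial_deriv i (partial_deriv j \<psi>) (\<lambda>k. F k x)
                             * carre_du_champ L (F i) (F j) x)"

text \<open>
  The infimum is taken in \<open>ereal\<close>, where \<open>1 / \<infinity> = 0\<close> and \<open>0 * (-\<infinity>) = 0\<close>.
\<close>

definition Ricci ::
  "('x \<Rightarrow> real) set \<Rightarrow> (('x \<Rightarrow> real) \<Rightarrow> 'x \<Rightarrow> real) \<Rightarrow> ereal \<Rightarrow> ('x \<Rightarrow> real) \<Rightarrow> 'x \<Rightarrow> ereal" where
  "Ricci A L N f x =
     (INF g \<in> {g \<in> A. carre_du_champ L (\<lambda>y. g y - f y) (\<lambda>y. g y - f y) x = 0}.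
        ereal (carre_du_champ2 L g g x) - 1 / N * ereal ((L g x)\<^sup>2))"

text \<open>
  The quotient \<open>(N - 2) (N' - 2) / (N' - N)\<close>, with its limit value at \<open>N' = \<infinity>\<close>.
\<close>

definition dim_coeff :: "real \<Rightarrow> ereal \<Rightarrow> real" where
  "dim_coeff N N' =
     (if N' = \<infinity> then N - 2
      else (N - 2) * (real_of_ereal N' - 2) / (real_of_ereal N' - N))"

end

theory Submission
  imports Defs
begin

text \<open>
  Fix a point \<open>x\<close> with \<open>f x \<noteq> 0\<close>, write \<open>h = log \<bar>f\<bar>\<close> near \<open>x\<close>, and let \<open>g\<close> be any test function for
  \<open>R'\<^sub>N\<^sub>'(u)\<close>. The time-changed \<open>\<Gamma>\<^sub>2\<close> of \<open>g\<close> contains, besides \<open>f\<^sup>4 \<Gamma>\<^sub>2(g)\<close>, the Hessian term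
  \<open>2 f\<^sup>4 \<Gamma>(h, \<Gamma>(g))\<close>, which the Ricci tensor at \<open>g\<close> does not control. It is absorbed by changing
  the test function to second order at \<open>x\<close>: passing from \<open>g\<close> to \<open>g + (h - h(x)) (g - g(x))\<close>
  keeps the gradient at \<open>x\<close> and adds \<open>dh \<otimes> dg + dg \<otimes> dh\<close> to the Hessian. If, as on a
  manifold, \<open>\<Gamma>\<^sub>2\<close> is the squared Hessian norm plus a term that depends on the gradient, then
  expanding the square produces exactly the Hessian term, together with \<open>2 \<Gamma>(h, g)\<^sup>2 + 2 \<Gamma>(h) \<Gamma>(g)\<close>. Since only the first-order
  behaviour of \<open>h\<close> at \<open>x\<close> matters, \<open>f / f(x) - 1\<close> can replace \<open>h - h(x)\<close>, and the new test
  function becomes \<open>f (g - g(x)) / f(x)\<close>, which lies in the algebra (\<open>twist\<close>,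
  \<open>square_field2_twist\<close>).

  The terms with \<open>\<Gamma>(h, \<Gamma>(g))\<close> and \<open>\<Gamma>\<^sub>2(g)\<close> now cancel. What remains is a quadratic
  inequality in \<open>p = \<Gamma>(h, g)\<close> and in the value \<open>l\<close> of \<open>L\<close> at the new test function, and the coefficient
  \<open>(N - 2) (N' - 2) / (N' - N)\<close> is the smallest for which it holds: it makes the form a
  perfect square (\<open>dimension_square\<close>). Points with \<open>f x = 0\<close> are degenerate; there both sides
  vanish.

  All computations rest on the derivation property of \<open>\<Gamma>\<close> (\<open>square_field_mult_left\<close>), which is
  the chain rule for the product of three variables.
\<close>

section \<open>Effective dimensions\<close>

text \<open>
  The parameter \<open>\<kappa> = 1 / N'\<close> treats finite and infinite \<open>N'\<close> alike.
\<close>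

lemma inverse_dimension:
  fixes N :: real and N' :: ereal
  assumes "1 \<le> N" "ereal N < N'"
  obtains \<kappa> :: real where "1 / N' = ereal \<kappa>" "\<kappa> * N < 1"
    "dim_coeff N N' = (N - 2) * (1 - 2 * \<kappa>) / (1 - \<kappa> * N)"
proof (cases N')
  case (real r)
  then have r: "N < r" "r > 0" using assms by auto
  have "dim_coeff N N' = (N - 2) * (1 - 2 * (1 / r)) / (1 - (1 / r) * N)"
    using r real by (simp add: dim_coeff_def divide_simps)
  moreover have "1 / N' = ereal (1 / r)" "1 / r * N < 1" using real r by (auto simp: one_ereal_def)
  ultimately show ?thesis by (rule that[rotated 2])
next
  case PInf
  then show ?thesis by (intro that[of 0]) (auto simp: dim_coeff_def zero_ereal_def[symmetric])
next
  case MInf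
  then show ?thesis using assms by simp
qed

text \<open>
  The difference of the two sides is \<open>(1 - \<kappa> N) / N\<close> times a square, because
  \<open>(N - 2) + 2 (1 - \<kappa> N) = N (1 - 2 \<kappa>)\<close>.
\<close>

lemma dimension_square:
  fixes N \<kappa> p l :: real
  assumes "1 \<le> N" "\<kappa> * N < 1"
  shows "2 * (1 - 2 * \<kappa>) * p * l \<le>
    (1 / N - \<kappa>) * l\<^sup>2 + ((N - 2) * (1 - 2 * \<kappa>) / (1 - \<kappa> * N) + 2 * (1 - 2 * \<kappa>)) * p\<^sup>2"
proof -
  have "(1 / N - \<kappa>) * l\<^sup>2 + ((N - 2) * (1 - 2 * \<kappa>) / (1 - \<kappa> * N) + 2 * (1 - 2 * \<kappa>)) * p\<^sup>2
      - 2 * (1 - 2 * \<kappa>) * p * l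
    = (1 - \<kappa> * N) / N * (l - N * (1 - 2 * \<kappa>) / (1 - \<kappa> * N) * p)\<^sup>2"
    (is "_ = ?square")
    using assms by (simp add: divide_simps) (simp add: algebra_simps power2_eq_square)
  moreover have "0 \<le> ?square" using assms by simp
  ultimately show ?thesis by linarith
qed

section \<open>Monomials in three variables\<close>

definition monomial3 :: "real \<Rightarrow> nat \<Rightarrow> nat \<Rightarrow> nat \<Rightarrow> (nat \<Rightarrow> real) \<Rightarrow> real" where
  "monomial3 c a b d = (\<lambda>y. c * y 0 ^ a * y 1 ^ b * y 2 ^ d)"

lemma partial_deriv_monomial3:
  "partial_deriv 0 (monomial3 c a b d) = monomial3 (c * real a) (a - 1) b d"
  "partial_deriv (Suc 0) (monomial3 c a b d) = monomial3 (c * real b) a (b - 1) d"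
  "partial_deriv 2 (monomial3 c a b d) = monomial3 (c * real d) a b (d - 1)"
  unfolding partial_deriv_def monomial3_def
  by (rule ext, rule DERIV_imp_deriv, auto intro!: derivative_eq_intros)+

text \<open>
  Smoothness asks about all iterated partial derivatives at once; the scaled monomials are
  stable under partial differentiation, so it suffices to look at one of them.
\<close>

lemma smooth_function_monomial3: "smooth_function 3 (monomial3 c a b d)"
proof -
  have deriv_monomial: "\<exists>c a b d. foldr partial_deriv is (monomial3 c0 a0 b0 d0) = monomial3 c a b d"
    if "set is \<subseteq> {..<3}" for "is" c0 a0 b0 d0
    using that
  proof (induction "is")
    case Nil
    then show ?case by auto
  next
    case (Cons i "is")
    then obtain c a b d
      where "foldr partial_deriv is (monomial3 c0 a0 b0 d0) = monomial3 c a b d" by auto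
    moreover have "i = 0 \<or> i = Suc 0 \<or> i = 2" using Cons.prems by auto
    ultimately show ?case by (elim disjE) (simp_all add: partial_deriv_monomial3, blast+)
  qed
  have cont: "continuous_on UNIV (monomial3 c a b d)" for c a b d
    unfolding monomial3_def
    by (intro continuous_intros continuous_on_product_coordinates)
  have diff: "(\<lambda>t. monomial3 c a b d (y(i := t))) differentiable (at s)" for c a b d y i s
    unfolding monomial3_def by (cases "i = 0"; cases "i = 1"; cases "i = 2") (auto intro!: derivative_intros)
  show ?thesis
    unfolding smooth_function_def
  proof (intro conjI allI impI)
    fix "is" :: "nat list" assume "set is \<subseteq> {..<3}"
    then obtain c' a' b' d'
      where "foldr partial_deriv is (monomial3 c a b d) = monomial3 c' a' b' d'"
      using deriv_monomial by blast
    then show "continuous_on UNIV (foldr partial_deriv is (monomial3 c a b d))"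
      and "(\<lambda>t. foldr partial_deriv is (monomial3 c a b d) (y(i := t))) differentiable (at (y i))"
      for i y by (simp_all add: cont diff)
  qed (simp add: monomial3_def)
qed

section \<open>Square field calculus\<close>

context diffusion_operator
begin

abbreviation square_field ("\<Gamma>") where "\<Gamma> \<equiv> carre_du_champ L"
abbreviation square_field2 ("\<Gamma>\<^sub>2") where "\<Gamma>\<^sub>2 \<equiv> carre_du_champ2 L"

lemma scale_mem: "f \<in> A \<Longrightarrow> (\<lambda>y. c * f y) \<in> A"
  and add_mem: "f \<in> A \<Longrightarrow> g \<in> A \<Longrightarrow> (\<lambda>y. f y + g y) \<in> A"
  and mult_mem: "f \<in> A \<Longrightarrow> g \<in> A \<Longrightarrow> (\<lambda>y. f y * g y) \<in> A"
  using algebra unfolding function_algebra_def by auto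

lemma diff_mem: "f \<in> A \<Longrightarrow> g \<in> A \<Longrightarrow> (\<lambda>y. f y - g y) \<in> A"
  using add_mem[OF _ scale_mem[of g "-1"], of f] by simp

lemma power2_mem: "f \<in> A \<Longrightarrow> (\<lambda>y. (f y)\<^sup>2) \<in> A"
  using mult_mem[of f f] by (simp add: power2_eq_square)

lemma L_diff: "f \<in> A \<Longrightarrow> g \<in> A \<Longrightarrow> L (\<lambda>y. f y - g y) = (\<lambda>y. L f y - L g y)"
  using add[OF _ scale_mem[of g "-1"], of f] scale[of g "-1"] by simp

lemma L_mult:
  "L (\<lambda>y. f y * g y) x = f x * L g x + g x * L f x + 2 * \<Gamma> f g x"
  by (simp add: carre_du_champ_def field_simps)

lemma square_field_mem: "f \<in> A \<Longrightarrow> g \<in> A \<Longrightarrow> \<Gamma> f g \<in> A"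
  unfolding carre_du_champ_def by (intro scale_mem diff_mem mult_mem maps_to)

lemmas mem = scale_mem add_mem mult_mem diff_mem power2_mem square_field_mem maps_to

lemma square_field_commute: "\<Gamma> f g x = \<Gamma> g f x"
  by (simp add: carre_du_champ_def mult.commute)

lemma square_field_add_left:
  assumes "f \<in> A" "g \<in> A" "h \<in> A"
  shows "\<Gamma> (\<lambda>y. f y + g y) h x = \<Gamma> f h x + \<Gamma> g h x"
  using assms by (simp add: carre_du_champ_def distrib_right add mem algebra_simps)

lemma square_field_scale_left:
  assumes "f \<in> A" "h \<in> A"
  shows "\<Gamma> (\<lambda>y. c * f y) h x = c * \<Gamma> f h x"
  using assms scale[OF mult_mem, of f h c] scale[of f c]
  by (simp add: carre_du_champ_def mult.assoc algebra_simps)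

lemma square_field_diff_left:
  assumes "f \<in> A" "g \<in> A" "h \<in> A"
  shows "\<Gamma> (\<lambda>y. f y - g y) h x = \<Gamma> f h x - \<Gamma> g h x"
  using assms by (simp add: carre_du_champ_def left_diff_distrib L_diff mem algebra_simps)

text \<open>
  The chain rule for \<open>y\<^sub>0 y\<^sub>1 y\<^sub>2\<close> expresses \<open>L (f g h)\<close> through \<open>L\<close> and \<open>\<Gamma>\<close> of the factors.
  Expanding \<open>L ((f g) h)\<close> by the definition of \<open>\<Gamma>\<close> instead and comparing gives the derivation
  property.
\<close>

lemma square_field_mult_left:
  assumes A: "f \<in> A" "g \<in> A" "h \<in> A"
  shows "\<Gamma> (\<lambda>y. f y * g y) h x = f x * \<Gamma> g h x + g x * \<Gamma> f h x"
proof -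
  define F where "F = (\<lambda>i::nat. if i = 0 then f else if i = Suc 0 then g else h)"
  have F: "F 0 = f" "F (Suc 0) = g" "F 2 = h" by (auto simp: F_def)
  have three: "{..<3::nat} = {0, Suc 0, 2}" by auto
  have "L (\<lambda>x. monomial3 1 1 1 1 (\<lambda>i. F i x)) x =
      (\<Sum>i<3. partial_deriv i (monomial3 1 1 1 1) (\<lambda>k. F k x) * L (F i) x) +
      (\<Sum>i<3. \<Sum>j<3. partial_deriv i (partial_deriv j (monomial3 1 1 1 1)) (\<lambda>k. F k x)
                             * \<Gamma> (F i) (F j) x)"
    by (rule chain_rule) (use A in \<open>auto simp: smooth_function_monomial3 F_def\<close>, simp add: monomial3_def)
  then have "L (\<lambda>y. f y * g y * h y) x =
      g x * h x * L f x + f x * h x * L g x + f x * g x * L h x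
      + 2 * (h x * \<Gamma> f g x + g x * \<Gamma> f h x + f x * \<Gamma> g h x)"
    unfolding three
    using square_field_commute[of g f x] square_field_commute[of h f x] square_field_commute[of h g x]
    by (simp add: partial_deriv_monomial3 F) (simp add: monomial3_def F algebra_simps)
  then show ?thesis
    using L_mult[of f g x] unfolding carre_du_champ_def[of L "\<lambda>y. f y * g y" h]
    by (simp add: algebra_simps)
qed

lemmas square_field_left =
  square_field_add_left square_field_scale_left square_field_diff_left square_field_mult_left

lemma square_field_add_right:
    "f \<in> A \<Longrightarrow> g \<in> A \<Longrightarrow> h \<in> A \<Longrightarrow> \<Gamma> h (\<lambda>y. f y + g y) x = \<Gamma> h f x + \<Gamma> h g x"
  and square_field_scale_right:
    "f \<in> A \<Longrightarrow> h \<in> A \<Longrightarrow> \<Gamma> h (\<lambda>y. c * f y) x = c * \<Gamma> h f x"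
  and square_field_diff_right:
    "f \<in> A \<Longrightarrow> g \<in> A \<Longrightarrow> h \<in> A \<Longrightarrow> \<Gamma> h (\<lambda>y. f y - g y) x = \<Gamma> h f x - \<Gamma> h g x"
  and square_field_mult_right:
    "f \<in> A \<Longrightarrow> g \<in> A \<Longrightarrow> h \<in> A \<Longrightarrow> \<Gamma> h (\<lambda>y. f y * g y) x = f x * \<Gamma> h g x + g x * \<Gamma> h f x"
  by (simp_all add: square_field_commute[of h] square_field_left)

lemmas square_field_right =
  square_field_add_right square_field_scale_right square_field_diff_right square_field_mult_right

text \<open>
  This is the degenerate case of the Cauchy-Schwarz inequality: otherwise the affine function
  \<open>t \<mapsto> \<Gamma>(h + t g)(x)\<close> would take negative values.
\<close>

lemma square_field_null:
  assumes "g \<in> A" "h \<in> A" and null: "\<Gamma> g g x = 0"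
  shows "\<Gamma> g h x = 0"
proof (rule ccontr)
  assume ne: "\<Gamma> g h x \<noteq> 0"
  \<comment> \<open>The parameter at which the affine function takes the value \<open>- 1\<close>.\<close>
  define t where "t = - (\<Gamma> h h x + 1) / (2 * \<Gamma> g h x)"
  have "0 \<le> \<Gamma> (\<lambda>y. h y + t * g y) (\<lambda>y. h y + t * g y) x"
    using assms by (intro carre_du_champ_nonneg mem)
  also have "\<dots> = \<Gamma> h h x + 2 * t * \<Gamma> g h x"
    using assms square_field_commute[of h g x]
    by (simp add: square_field_left square_field_right mem)
  also have "\<dots> = - 1" using ne by (simp add: t_def field_simps)
  finally show False by simp
qed

lemma square_field_cong:
  assumes "g \<in> A" "u \<in> A" "h \<in> A" "\<Gamma> (\<lambda>y. g y - u y) (\<lambda>y. g y - u y) x = 0"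
  shows "\<Gamma> g h x = \<Gamma> u h x"
  using square_field_null[of "\<lambda>y. g y - u y" h x] assms
  by (simp add: square_field_left mem)

lemma square_field_power2_diag:
  assumes "f \<in> A"
  shows "\<Gamma> (\<lambda>y. (f y)\<^sup>2) (\<lambda>y. (f y)\<^sup>2) x = 4 * (f x)\<^sup>2 * \<Gamma> f f x"
  using assms by (simp add: power2_eq_square square_field_left square_field_right mem)

lemma square_field2_diag: "\<Gamma>\<^sub>2 g g x = L (\<Gamma> g g) x / 2 - \<Gamma> g (L g) x"
  by (simp add: carre_du_champ2_def)

section \<open>The twisted test function\<close>

text \<open>
  This is \<open>f (g - g x) / f x\<close>, multiplied out because the constants need not belong to \<open>A\<close>.
  The factor is \<open>inverse (f x)\<close> rather than a quotient, so that simplification does not push the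
  constant into the arguments of \<open>L\<close> and \<open>\<Gamma>\<close>.
\<close>

definition twist :: "('x \<Rightarrow> real) \<Rightarrow> 'x \<Rightarrow> ('x \<Rightarrow> real) \<Rightarrow> 'x \<Rightarrow> real" where
  "twist f x g = (\<lambda>y. inverse (f x) * (f y * g y - g x * f y))"

lemma twist_mem: "f \<in> A \<Longrightarrow> g \<in> A \<Longrightarrow> twist f x g \<in> A"
  unfolding twist_def by (intro mem)

lemma square_field_twist:
  assumes "f \<in> A" "g \<in> A" "h \<in> A"
  shows "\<Gamma> (twist f x g) h y = inverse (f x) * (f y * \<Gamma> g h y + (g y - g x) * \<Gamma> f h y)"
  unfolding twist_def using assms by (simp add: square_field_left mem) (simp add: algebra_simps)

lemma L_twist_fun:
  assumes "f \<in> A" "g \<in> A"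
  shows "L (twist f x g) =
    (\<lambda>y. inverse (f x) * (f y * L g y + g y * L f y - g x * L f y + 2 * \<Gamma> f g y))"
  unfolding twist_def using assms
  by (simp add: scale L_diff L_mult mem) (simp add: algebra_simps)

lemma L_twist:
  assumes "f \<in> A" "g \<in> A" "f x \<noteq> 0"
  shows "L (twist f x g) x = L g x + 2 * \<Gamma> f g x / f x"
  using assms by (simp add: L_twist_fun field_simps)

text \<open>
  The right-hand side is \<open>(f\<^sup>2 \<Gamma>(g) + 2 f (g - g x) \<Gamma>(f, g) + (g - g x)\<^sup>2 \<Gamma>(f)) / (f x)\<^sup>2\<close>, expanded into a
  linear combination of products of elements of \<open>A\<close> to which \<open>L\<close> can be applied term by term.
\<close>

lemma square_field_twist_diag:
  assumes "f \<in> A" "g \<in> A"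
  shows "\<Gamma> (twist f x g) (twist f x g) = (\<lambda>y. (inverse (f x))\<^sup>2 *
      ((f y)\<^sup>2 * \<Gamma> g g y + (2 * (g y * (f y * \<Gamma> f g y)) - 2 * g x * (f y * \<Gamma> f g y))
       + ((g y)\<^sup>2 * \<Gamma> f f y - 2 * g x * (g y * \<Gamma> f f y) + (g x)\<^sup>2 * \<Gamma> f f y)))"
proof
  fix y
  note commute = square_field_commute[of f "twist f x g" y] square_field_commute[of g "twist f x g" y]
    square_field_commute[of g f y]
  show "\<Gamma> (twist f x g) (twist f x g) y = (inverse (f x))\<^sup>2 *
      ((f y)\<^sup>2 * \<Gamma> g g y + (2 * (g y * (f y * \<Gamma> f g y)) - 2 * g x * (f y * \<Gamma> f g y))
       + ((g y)\<^sup>2 * \<Gamma> f f y - 2 * g x * (g y * \<Gamma> f f y) + (g x)\<^sup>2 * \<Gamma> f f y))"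
    using assms
    by (simp add: square_field_twist twist_mem commute) (simp add: power2_eq_square algebra_simps)
qed

text \<open>
  In the Riemannian case this expands the squared norm of the Hessian of \<open>g\<close> plus \<open>(df \<otimes> dg + dg \<otimes> df) / f x\<close>, since
  the Hessian of \<open>g\<close> evaluated at \<open>df, dg\<close> is \<open>\<Gamma>(f, \<Gamma>(g)) / 2\<close>. The terms with \<open>\<Gamma>(g, \<Gamma>(f, g))\<close>, which
  involve the Hessian of \<open>f\<close>, and the terms with \<open>L f\<close> cancel between the two parts of \<open>\<Gamma>\<^sub>2\<close>.
\<close>

lemma square_field2_twist:
  assumes A: "f \<in> A" "g \<in> A" and fx: "f x \<noteq> 0"
  shows "\<Gamma>\<^sub>2 (twist f x g) (twist f x g) x =
    \<Gamma>\<^sub>2 g g x + 2 * \<Gamma> f (\<Gamma> g g) x / f x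
    + 2 * ((\<Gamma> f g x)\<^sup>2 + \<Gamma> f f x * \<Gamma> g g x) / (f x)\<^sup>2"
proof -
  note [simp] = L_mult add scale L_diff mem square_field_left square_field_right A
  have com: "\<Gamma> g f = \<Gamma> f g" by (rule ext) (rule square_field_commute)
  have com2: "\<Gamma> (\<Gamma> g g) f x = \<Gamma> f (\<Gamma> g g) x" "\<Gamma> (\<Gamma> f g) g x = \<Gamma> g (\<Gamma> f g) x"
    by (rule square_field_commute)+
  have L_part: "L (\<Gamma> (twist f x g) (twist f x g)) x = (inverse (f x))\<^sup>2 *
    ((2 * f x * L f x + 2 * \<Gamma> f f x) * \<Gamma> g g x + (f x)\<^sup>2 * L (\<Gamma> g g) x + 4 * f x * \<Gamma> f (\<Gamma> g g) x
     + 2 * f x * \<Gamma> f g x * L g x + 4 * (\<Gamma> f g x)\<^sup>2 + 4 * f x * \<Gamma> g (\<Gamma> f g) x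
     + 2 * \<Gamma> f f x * \<Gamma> g g x)"
    unfolding square_field_twist_diag[OF A]
    by (simp add: com com2 power2_eq_square mult.assoc) (simp add: algebra_simps)
  have \<Gamma>_part: "\<Gamma> (twist f x g) (L (twist f x g)) x =
     inverse (f x) * (\<Gamma> f g x * L g x + f x * \<Gamma> g (L g) x + \<Gamma> g g x * L f x + 2 * \<Gamma> g (\<Gamma> f g) x)"
    using fx
    by (simp add: square_field_twist twist_mem L_twist_fun com) (simp add: field_simps)
  show ?thesis
    unfolding square_field2_diag L_part \<Gamma>_part using fx
    by (simp add: field_simps power2_eq_square)
qed

text \<open>
  Twisting does not change the gradient at \<open>x\<close>, so it maps test functions to test functions.
\<close>

lemma twist_test_function:
  assumes A: "f \<in> A" "g \<in> A" "u \<in> A" and fx: "f x \<noteq> 0"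
    and null: "\<Gamma> (\<lambda>y. g y - u y) (\<lambda>y. g y - u y) x = 0"
  shows "\<Gamma> (\<lambda>y. twist f x g y - u y) (\<lambda>y. twist f x g y - u y) x = 0"
proof -
  have "\<Gamma> (\<lambda>y. twist f x g y - u y) h x = 0" if "h \<in> A" for h
    using that A fx square_field_cong[OF A(2,3) that null]
    by (simp add: square_field_left square_field_twist twist_mem)
  then show ?thesis using A by (simp add: mem twist_mem)
qed

section \<open>Time change by the factor \<open>f\<^sup>2\<close>\<close>

context
  fixes f :: "'x \<Rightarrow> real" and L' :: "('x \<Rightarrow> real) \<Rightarrow> 'x \<Rightarrow> real"
  assumes f: "f \<in> A" and L': "\<And>v. v \<in> A \<Longrightarrow> L' v = (\<lambda>y. (f y)\<^sup>2 * L v y)"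
begin

lemma square_field_time_change:
  "g \<in> A \<Longrightarrow> h \<in> A \<Longrightarrow> carre_du_champ L' g h = (\<lambda>y. (f y)\<^sup>2 * \<Gamma> g h y)"
  by (rule ext) (simp add: carre_du_champ_def L' mem algebra_simps)

lemma square_field2_time_change:
  assumes g: "g \<in> A"
  shows "carre_du_champ2 L' g g x =
    (f x)^4 * \<Gamma>\<^sub>2 g g x + (f x)\<^sup>2 * L (\<lambda>y. (f y)\<^sup>2) x * \<Gamma> g g x / 2
    + 2 * (f x)^3 * (\<Gamma> f (\<Gamma> g g) x - \<Gamma> f g x * L g x)"
proof -
  have sq: "\<Gamma> (\<lambda>y. (f y)\<^sup>2) h x = 2 * f x * \<Gamma> f h x" if "h \<in> A" for h
    using square_field_mult_left[of f f h x] f that by (simp add: power2_eq_square)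
  have "carre_du_champ2 L' g g x =
    (f x)\<^sup>2 * L (\<lambda>y. (f y)\<^sup>2 * \<Gamma> g g y) x / 2 - (f x)\<^sup>2 * \<Gamma> g (\<lambda>y. (f y)\<^sup>2 * L g y) x"
    using g f by (simp add: carre_du_champ2_def L' square_field_time_change mem algebra_simps)
  also have "L (\<lambda>y. (f y)\<^sup>2 * \<Gamma> g g y) x =
     (f x)\<^sup>2 * L (\<Gamma> g g) x + \<Gamma> g g x * L (\<lambda>y. (f y)\<^sup>2) x + 4 * f x * \<Gamma> f (\<Gamma> g g) x"
    using g f by (simp add: L_mult sq mem)
  also have "\<Gamma> g (\<lambda>y. (f y)\<^sup>2 * L g y) x = (f x)\<^sup>2 * \<Gamma> g (L g) x + 2 * f x * \<Gamma> f g x * L g x"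
    using g f sq[of g] square_field_commute[of g "\<lambda>y. (f y)\<^sup>2" x]
    by (simp add: square_field_mult_right mem)
  finally show ?thesis
    by (simp add: square_field2_diag algebra_simps power2_eq_square power3_eq_cube power4_eq_xxxx)
qed

text \<open>
  The quantities minimised in the two Ricci tensors are compared one test function at a time: \<open>g\<close> for \<open>L'\<close>
  is matched with its twist for \<open>L\<close>. After substituting the formulas for both \<open>\<Gamma>\<^sub>2\<close>, the term
  \<open>\<Gamma>(f, \<Gamma>(g))\<close> cancels, and the difference is \<open>(f x)\<^sup>4\<close> times the quadratic form of
  \<open>dimension_square\<close>.
\<close>

lemma time_change_integrand_bound:
  fixes N \<kappa> :: real
  assumes g: "g \<in> A" and fx: "f x \<noteq> 0" and N: "1 \<le> N" "\<kappa> * N < 1"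
  shows "carre_du_champ2 L' g g x - \<kappa> * (L' g x)\<^sup>2 \<ge>
    (f x)^4 * (\<Gamma>\<^sub>2 (twist f x g) (twist f x g) x - (L (twist f x g) x)\<^sup>2 / N)
    - (N - 2) * (1 - 2 * \<kappa>) / (1 - \<kappa> * N) * (f x)\<^sup>2 * (\<Gamma> f g x)\<^sup>2
    + 1/2 * ((f x)\<^sup>2 * L (\<lambda>y. (f y)\<^sup>2) x - \<Gamma> (\<lambda>y. (f y)\<^sup>2) (\<lambda>y. (f y)\<^sup>2) x) * \<Gamma> g g x"
proof -
  define p where "p = \<Gamma> f g x / f x"
  define l where "l = L g x + 2 * p"
  define C where "C = (N - 2) * (1 - 2 * \<kappa>) / (1 - \<kappa> * N)"
  have p: "\<Gamma> f g x = f x * p" using fx by (simp add: p_def)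
  have twist: "L (twist f x g) x = l" using L_twist[of f g x] f g fx by (simp add: l_def p_def)
  have Lg: "L g x = l - 2 * p" by (simp add: l_def)
  have "(f x)^4 * (2 * (1 - 2 * \<kappa>) * p * l) \<le>
      (f x)^4 * ((1 / N - \<kappa>) * l\<^sup>2 + (C + 2 * (1 - 2 * \<kappa>)) * p\<^sup>2)"
    unfolding C_def by (intro mult_left_mono dimension_square N) simp
  moreover have twist2: "(f x)^4 * \<Gamma>\<^sub>2 (twist f x g) (twist f x g) x = (f x)^4 * \<Gamma>\<^sub>2 g g x
      + 2 * (f x)^3 * \<Gamma> f (\<Gamma> g g) x + 2 * (f x)^4 * p\<^sup>2 + 2 * (f x)\<^sup>2 * \<Gamma> f f x * \<Gamma> g g x"
    unfolding square_field2_twist[OF f g fx] p using fx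
    by (simp add: field_simps power2_eq_square power3_eq_cube power4_eq_xxxx)
  moreover have "carre_du_champ2 L' g g x - \<kappa> * (L' g x)\<^sup>2 -
    ((f x)^4 * (\<Gamma>\<^sub>2 (twist f x g) (twist f x g) x - l\<^sup>2 / N)
    - C * (f x)\<^sup>2 * (\<Gamma> f g x)\<^sup>2
    + 1/2 * ((f x)\<^sup>2 * L (\<lambda>y. (f y)\<^sup>2) x - \<Gamma> (\<lambda>y. (f y)\<^sup>2) (\<lambda>y. (f y)\<^sup>2) x) * \<Gamma> g g x)
    = (f x)^4 * ((1 / N - \<kappa>) * l\<^sup>2 + (C + 2 * (1 - 2 * \<kappa>)) * p\<^sup>2)
      - (f x)^4 * (2 * (1 - 2 * \<kappa>) * p * l)"
    unfolding right_diff_distrib[of "(f x)^4"] twist2 square_field2_time_change[OF g]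
      square_field_power2_diag[OF f] L'[OF g] Lg p divide_inverse
    by (simp add: algebra_simps power2_eq_square power3_eq_cube power4_eq_xxxx)
  ultimately show ?thesis unfolding C_def twist by linarith
qed

lemma square_field2_time_change_zero:
  assumes "g \<in> A" "f x = 0"
  shows "carre_du_champ2 L' g g x = 0"
  using assms by (simp add: square_field2_time_change)

end

end

section \<open>The Ricci tensor of the time-changed operator\<close>

theorem corollary8p8:
  fixes A :: "('x \<Rightarrow> real) set"
    and L L' :: "('x \<Rightarrow> real) \<Rightarrow> 'x \<Rightarrow> real"
    and f u :: "'x \<Rightarrow> real"
    and N :: real and N' :: ereal and x :: 'x
  assumes "diffusion_operator A L"
    and "f \<in> A"
    and "\<And>v. v \<in> A \<Longrightarrow> L' v = (\<lambda>y. (f y)\<^sup>2 * L v y)"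
    and "1 \<le> N" and "ereal N < N'"
    and "u \<in> A"
  shows "Ricci A L' N' u x \<ge>
           ereal (f x ^ 4) * Ricci A L (ereal N) u x
           - ereal (dim_coeff N N' * (f x)\<^sup>2 * (carre_du_champ L f u x)\<^sup>2)
           + ereal (1/2 * ((f x)\<^sup>2 * L (\<lambda>y. (f y)\<^sup>2) x
                           - carre_du_champ L (\<lambda>y. (f y)\<^sup>2) (\<lambda>y. (f y)\<^sup>2) x)
                        * carre_du_champ L u u x)"
    (is "?bound \<le> _")
proof -
  interpret diffusion_operator A L by fact
  obtain \<kappa> where \<kappa>: "1 / N' = ereal \<kappa>" "\<kappa> * N < 1"
    "dim_coeff N N' = (N - 2) * (1 - 2 * \<kappa>) / (1 - \<kappa> * N)"
    using inverse_dimension[OF assms(4,5)] .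
  have "?bound \<le> ereal (carre_du_champ2 L' g g x) - 1 / N' * ereal ((L' g x)\<^sup>2)"
    if g: "g \<in> A" and null': "carre_du_champ L' (\<lambda>y. g y - u y) (\<lambda>y. g y - u y) x = 0" for g
  proof (cases "f x = 0")
    case True
    \<comment> \<open>Both sides vanish; the first summand of the bound does so even if the Ricci tensor is \<open>-\<infinity>\<close>.\<close>
    have "?bound = 0"
      using True square_field_power2_diag[OF assms(2), of x]
      by (simp add: zero_ereal_def[symmetric])
    moreover have "L' g x = 0" using True g assms(3) by simp
    ultimately show ?thesis
      using square_field2_time_change_zero[OF assms(2,3) g True] \<kappa>(1)
      by (simp add: zero_ereal_def[symmetric])
  next
    case False
    then have null: "\<Gamma> (\<lambda>y. g y - u y) (\<lambda>y. g y - u y) x = 0"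
      using null' g assms(6) square_field_time_change[OF assms(2,3)] by (simp add: diff_mem)
    let ?v = "twist f x g"
    let ?e = "\<Gamma>\<^sub>2 ?v ?v x - (L ?v x)\<^sup>2 / N"
    have "Ricci A L (ereal N) u x \<le> ereal (\<Gamma>\<^sub>2 ?v ?v x) - 1 / ereal N * ereal ((L ?v x)\<^sup>2)"
      unfolding Ricci_def
      by (rule INF_lower)
         (use twist_mem twist_test_function[OF assms(2) g assms(6) False null] assms(2) g in auto)
    also have "\<dots> = ereal ?e" using assms(4) by (simp add: one_ereal_def)
    finally have "ereal (f x ^ 4) * Ricci A L (ereal N) u x \<le> ereal (f x ^ 4) * ereal ?e"
      by (rule ereal_mult_left_mono) simp
    then have "?bound \<le> ereal (f x ^ 4) * ereal ?e
           - ereal (dim_coeff N N' * (f x)\<^sup>2 * (\<Gamma> f u x)\<^sup>2)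
           + ereal (1/2 * ((f x)\<^sup>2 * L (\<lambda>y. (f y)\<^sup>2) x
                           - \<Gamma> (\<lambda>y. (f y)\<^sup>2) (\<lambda>y. (f y)\<^sup>2) x) * \<Gamma> u u x)"
      by (intro add_right_mono ereal_minus_mono order_refl)
    also have "\<dots> \<le> ereal (carre_du_champ2 L' g g x - \<kappa> * (L' g x)\<^sup>2)"
    proof -
      note cong = square_field_cong[OF g assms(6) _ null]
      have "\<Gamma> f g x = \<Gamma> f u x" "\<Gamma> g g x = \<Gamma> u u x"
        using cong[OF assms(2)] cong[OF g] cong[OF assms(6)] square_field_commute[of _ _ x]
        by metis+
      then show ?thesis
        using time_change_integrand_bound[OF assms(2,3) g False assms(4) \<kappa>(2)] \<kappa>(3)
        by simp
    qed
    also have "\<dots> = ereal (carre_du_champ2 L' g g x) - 1 / N' * ereal ((L' g x)\<^sup>2)"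
      by (simp add: \<kappa>(1))
    finally show ?thesis .
  qed
  then show ?thesis unfolding Ricci_def by (intro INF_greatest) auto
qed

end
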